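(* Let $R=\mathbb F_{q_1}\times\cdots\times\mathbb F_{q_t}$ be a finite product of finite fields, and let $A\ne B$ be distinct nonempty proper subsets of $[t]$. Then $|A^c\cup B^c|\ge 2$. Hence $X_A$ and $X_B$ are completely joined in $\mathcal D(R)$ if and only if $A\cap B\ne\emptyset$.
   Context: $[t]=\{1,\dots,t\}$, and $A^c=[t]\setminus A$. $Z(R)$ is the set of zero-divisors of $R$ and $Z(R)^*=Z(R)\setminus\{0\}$. For $x=(x_1,\dots,x_t)\in R$, $\operatorname{supp}(x)=\{i\in[t]: x_i\ne 0\}$. For nonempty proper $A\subsetneq[t]$, $X_A=\{x\in Z(R)^*:\operatorname{supp}(x)=A\}$. All graphs are simple. $\Gamma(R)$ has vertex set $Z(R)^*$, with distinct $x,y$ adjacent iff $xy=0$. $W\Gamma(R)$ has vertex set $Z(R)^*$, with distinct $x,y$ adjacent iff there exist nonzero $r\in\operatorname{Ann}(x)$ and nonzero $s\in\operatorname{Ann}(y)$ with $rs=0$. The weak zero-divisor difference graph $\mathcal D(R)$ is the graph on $Z(R)^*$ with edge set $E(W\Gamma(R))\setminus E(\Gamma(R))$, with resulting isolated vertices deleted; $x,y\in Z(R)^*$ are adjacent in $\mathcal D(R)$ iff $\{x,y\}\in E(W\Gamma(R))\setminus E(\Gamma(R))$. "Completely joined" means that every element of $X_A$ is adjacent to every element of $X_B$. *)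

theory Defs
  imports "HOL-Algebra.Chinese_Remainder" "Graph_Theory.Pair_Digraph"
begin

section \<open>Zero-divisors and annihilators\<close>

text \<open>All notions are meant for commutative rings. Zero counts as a zero-divisor of a nonzero
  ring, so the starred set really removes something.\<close>

definition zero_divisors :: "('a, 'm) ring_scheme \<Rightarrow> 'a set" where
  "zero_divisors R =
     {x \<in> carrier R. \<exists>y \<in> carrier R. y \<noteq> \<zero>\<^bsub>R\<^esub> \<and> x \<otimes>\<^bsub>R\<^esub> y = \<zero>\<^bsub>R\<^esub>}"

definition nonzero_zero_divisors :: "('a, 'm) ring_scheme \<Rightarrow> 'a set" where
  "nonzero_zero_divisors R = zero_divisors R - {\<zero>\<^bsub>R\<^esub>}"

definition Ann :: "('a, 'm) ring_scheme \<Rightarrow> 'a \<Rightarrow> 'a set" where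
  "Ann R x = {r \<in> carrier R. r \<otimes>\<^bsub>R\<^esub> x = \<zero>\<^bsub>R\<^esub>}"


section \<open>The graphs\<close>

text \<open>Simple graphs are symmetric loop-free digraphs, as in the library: an edge \<open>{x, y}\<close>
  is represented by the two arcs \<open>(x, y)\<close> and \<open>(y, x)\<close>.\<close>

definition zero_divisor_graph :: "('a, 'm) ring_scheme \<Rightarrow> 'a pair_pre_digraph" where
  "zero_divisor_graph R =
     \<lparr> pverts = nonzero_zero_divisors R,
       parcs = {(x, y). x \<in> nonzero_zero_divisors R \<and> y \<in> nonzero_zero_divisors R \<and>
                  x \<noteq> y \<and> x \<otimes>\<^bsub>R\<^esub> y = \<zero>\<^bsub>R\<^esub>} \<rparr>"

definition weak_zero_divisor_graph :: "('a, 'm) ring_scheme \<Rightarrow> 'a pair_pre_digraph" where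
  "weak_zero_divisor_graph R =
     \<lparr> pverts = nonzero_zero_divisors R,
       parcs = {(x, y). x \<in> nonzero_zero_divisors R \<and> y \<in> nonzero_zero_divisors R \<and>
                  x \<noteq> y \<and>
                  (\<exists>r \<in> Ann R x. \<exists>s \<in> Ann R y.
                     r \<noteq> \<zero>\<^bsub>R\<^esub> \<and> s \<noteq> \<zero>\<^bsub>R\<^esub> \<and> r \<otimes>\<^bsub>R\<^esub> s = \<zero>\<^bsub>R\<^esub>)} \<rparr>"

definition delete_isolated :: "'a pair_pre_digraph \<Rightarrow> 'a pair_pre_digraph" where
  "delete_isolated G =
     \<lparr> pverts = {v \<in> pverts G. \<exists>w. (v, w) \<in> parcs G \<or> (w, v) \<in> parcs G}, parcs = parcs G \<rparr>"

definition weak_difference_graph :: "('a, 'm) ring_scheme \<Rightarrow> 'a pair_pre_digraph" where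
  "weak_difference_graph R =
     delete_isolated
       \<lparr> pverts = nonzero_zero_divisors R,
         parcs = parcs (weak_zero_divisor_graph R) - parcs (zero_divisor_graph R) \<rparr>"

definition completely_joined :: "'a pair_pre_digraph \<Rightarrow> 'a set \<Rightarrow> 'a set \<Rightarrow> bool" where
  "completely_joined G X Y \<longleftrightarrow> (\<forall>x \<in> X. \<forall>y \<in> Y. (x, y) \<in> parcs G)"

lemma pair_graph_zero_divisor_graph:
  assumes "cring R" "finite (carrier R)"
  shows "pair_graph (zero_divisor_graph R)"
proof -
  interpret cring R by fact
  have fin: "finite (nonzero_zero_divisors R)"
    by (rule finite_subset[OF _ assms(2)])
       (auto simp: nonzero_zero_divisors_def zero_divisors_def)
  have "finite (parcs (zero_divisor_graph R))"
    by (rule finite_subset[of _ "nonzero_zero_divisors R \<times> nonzero_zero_divisors R"])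
       (auto simp: fin zero_divisor_graph_def)
  moreover have "symmetric (zero_divisor_graph R)"
    by (auto simp: symmetric_def sym_def arcs_ends_def arc_to_ends_def zero_divisor_graph_def
        with_proj_def nonzero_zero_divisors_def zero_divisors_def m_comm)
  ultimately show ?thesis
    by unfold_locales (auto simp: fin zero_divisor_graph_def)
qed

lemma pair_graph_weak_difference_graph:
  assumes "cring R" "finite (carrier R)"
  shows "pair_graph (weak_difference_graph R)" (is "pair_graph ?D")
proof -
  interpret cring R by fact
  let ?Z = "nonzero_zero_divisors R"
  have fin: "finite ?Z"
    by (rule finite_subset[OF _ assms(2)])
       (auto simp: nonzero_zero_divisors_def zero_divisors_def)
  note defs = weak_difference_graph_def delete_isolated_def weak_zero_divisor_graph_def
    zero_divisor_graph_def
  have arc: "x \<in> ?Z" "y \<in> ?Z" "x \<noteq> y" if "(x, y) \<in> parcs ?D" for x y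
    using that by (simp_all add: defs)
  have verts: "v \<in> pverts ?D \<longleftrightarrow> v \<in> ?Z \<and> (\<exists>w. (v, w) \<in> parcs ?D \<or> (w, v) \<in> parcs ?D)" for v
    by (simp add: weak_difference_graph_def delete_isolated_def)
  have fin_verts: "finite (pverts ?D)"
    by (rule finite_subset[OF _ fin]) (use verts in blast)
  have fin_arcs: "finite (parcs ?D)"
    by (rule finite_subset[of _ "?Z \<times> ?Z"]) (use arc fin in auto)
  have "(y, x) \<in> parcs ?D" if "(x, y) \<in> parcs ?D" for x y
    using that
    by (simp add: defs nonzero_zero_divisors_def zero_divisors_def Ann_def) (metis m_comm)
  hence "symmetric (with_proj ?D)"
    by (auto simp: symmetric_def sym_def arcs_ends_def arc_to_ends_def with_proj_def)
  then show ?thesis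
    by unfold_locales (use verts arc fin_verts fin_arcs in auto)
qed


section \<open>Supports in a finite product of rings\<close>

text \<open>The elements of \<open>RDirProd_list Fs\<close> are lists, indexed from 0, whereas coordinates are
  numbered by \<open>{1..t}\<close>: coordinate \<open>i\<close> is the list entry \<open>i - 1\<close>.\<close>

definition supp :: "('a, 'm) ring_scheme list \<Rightarrow> 'a list \<Rightarrow> nat set" where
  "supp Fs x = {i \<in> {1..length Fs}. x ! (i - 1) \<noteq> \<zero>\<^bsub>Fs ! (i - 1)\<^esub>}"

definition supp_class :: "('a, 'm) ring_scheme list \<Rightarrow> nat set \<Rightarrow> 'a list set" where
  "supp_class Fs A = {x \<in> nonzero_zero_divisors (RDirProd_list Fs). supp Fs x = A}"

lemma RDirProd_list_mult_Cons:
  assumes "a \<in> carrier G" "b \<in> carrier G"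
    and "as \<in> carrier (RDirProd_list Gs)" "bs \<in> carrier (RDirProd_list Gs)"
  shows "(a # as) \<otimes>\<^bsub>RDirProd_list (G # Gs)\<^esub> (b # bs) =
           (a \<otimes>\<^bsub>G\<^esub> b) # (as \<otimes>\<^bsub>RDirProd_list Gs\<^esub> bs)"
proof -
  have "(\<lambda>(a, as). a # as) \<in> ring_hom (RDirProd G (RDirProd_list Gs)) (RDirProd_list (G # Gs))"
    using RDirProd_list_iso1[of G Gs] by (simp add: ring_iso_def)
  from ring_hom_mult[OF this, of "(a, as)" "(b, bs)"] show ?thesis
    using assms by (simp add: RDirProd_carrier) (simp add: RDirProd_def DirProd_def monoid.defs)
qed

lemma RDirProd_list_mult_nth:
  assumes "x \<in> carrier (RDirProd_list Fs)" "y \<in> carrier (RDirProd_list Fs)" "i < length Fs"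
  shows "(x \<otimes>\<^bsub>RDirProd_list Fs\<^esub> y) ! i = x ! i \<otimes>\<^bsub>Fs ! i\<^esub> y ! i"
  using assms
proof (induction Fs arbitrary: x y i)
  case (Cons G Gs)
  then obtain a as b bs where
    "x = a # as" "a \<in> carrier G" "as \<in> carrier (RDirProd_list Gs)"
    "y = b # bs" "b \<in> carrier G" "bs \<in> carrier (RDirProd_list Gs)"
    by (auto simp: RDirProd_list_carrier)
  with Cons show ?case
    by (cases i) (auto simp: RDirProd_list_mult_Cons)
qed simp

lemma RDirProd_list_zero_nth:
  "i < length Fs \<Longrightarrow> \<zero>\<^bsub>RDirProd_list Fs\<^esub> ! i = \<zero>\<^bsub>Fs ! i\<^esub>"
  by (induction Fs arbitrary: i) (auto simp: RDirProd_list_zero nth_Cons split: nat.split)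

end

theory Submission
  imports Defs
begin

text \<open>Over a product of fields everything is read off supports: \<open>x y = 0\<close> means that the supports
  of \<open>x\<close> and \<open>y\<close> are disjoint. Two distinct proper subsets \<open>A\<close> and \<open>B\<close> miss two different
  coordinates \<open>i \<notin> A\<close> and \<open>j \<notin> B\<close>, and the idempotents at \<open>i\<close> and \<open>j\<close> annihilate \<open>X\<^sub>A\<close> and \<open>X\<^sub>B\<close>
  and each other. Hence all of \<open>X\<^sub>A\<close> and \<open>X\<^sub>B\<close> is weakly adjacent, and only the condition
  \<open>x y \<noteq> 0\<close> remains.\<close>

lemma RDirProd_list_carrier_iff:
  "x \<in> carrier (RDirProd_list Fs) \<longleftrightarrow>
     length x = length Fs \<and> (\<forall>i < length Fs. x ! i \<in> carrier (Fs ! i))"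
  by (auto intro: RDirProd_list_carrier_memI dest: RDirProd_list_carrier_mem)

text \<open>Turns equations with zero in the product ring into statements about index sets, so that
  later arguments compare supports instead of list entries.\<close>

lemma supp_eq_empty_iff:
  assumes "ring (RDirProd_list Fs)" and x: "x \<in> carrier (RDirProd_list Fs)"
  shows "supp Fs x = {} \<longleftrightarrow> x = \<zero>\<^bsub>RDirProd_list Fs\<^esub>"
proof -
  interpret ring "RDirProd_list Fs" by fact
  have "length x = length Fs" "length \<zero>\<^bsub>RDirProd_list Fs\<^esub> = length Fs"
    using x zero_closed by (simp_all add: RDirProd_list_carrier_iff)
  hence "x = \<zero>\<^bsub>RDirProd_list Fs\<^esub> \<longleftrightarrow> (\<forall>k < length Fs. x ! k = \<zero>\<^bsub>Fs ! k\<^esub>)"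
    by (simp add: list_eq_iff_nth_eq RDirProd_list_zero_nth)
  also have "\<dots> \<longleftrightarrow> supp Fs x = {}"
  proof
    assume "supp Fs x = {}"
    \<comment> \<open>List position \<open>k\<close> carries coordinate \<open>Suc k\<close>, since
      coordinates start at 1.\<close>
    then have "Suc k \<notin> supp Fs x" for k by simp
    thus "\<forall>k < length Fs. x ! k = \<zero>\<^bsub>Fs ! k\<^esub>" by (auto simp: supp_def)
  qed (auto simp: supp_def)
  finally show ?thesis by blast
qed

text \<open>The inclusion from left to right holds in any product of rings; the converse holds
  because no factor has proper zero-divisors.\<close>

lemma supp_mult:
  assumes "\<And>i. i < length Fs \<Longrightarrow> domain (Fs ! i)"
    and xy: "x \<in> carrier (RDirProd_list Fs)" "y \<in> carrier (RDirProd_list Fs)"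
  shows "supp Fs (x \<otimes>\<^bsub>RDirProd_list Fs\<^esub> y) = supp Fs x \<inter> supp Fs y"
proof -
  have "(x \<otimes>\<^bsub>RDirProd_list Fs\<^esub> y) ! (i - 1) \<noteq> \<zero>\<^bsub>Fs ! (i - 1)\<^esub> \<longleftrightarrow>
          x ! (i - 1) \<noteq> \<zero>\<^bsub>Fs ! (i - 1)\<^esub> \<and> y ! (i - 1) \<noteq> \<zero>\<^bsub>Fs ! (i - 1)\<^esub>"
    if "i \<in> {1..length Fs}" for i
  proof -
    have k: "i - 1 < length Fs" using that by auto
    interpret domain "Fs ! (i - 1)" using assms(1) k by blast
    have "x ! (i - 1) \<in> carrier (Fs ! (i - 1))" "y ! (i - 1) \<in> carrier (Fs ! (i - 1))"
      using xy k by (simp_all only: RDirProd_list_carrier_iff)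
    thus ?thesis
      using xy k by (simp only: RDirProd_list_mult_nth integral_iff de_Morgan_disj)
  qed
  thus ?thesis unfolding supp_def by blast
qed

text \<open>Over rings this is the idempotent of the product that belongs to \<open>A\<close>.
  Singletons \<open>A\<close> give annihilators, and \<open>A\<close> itself gives a canonical
  element of its support class.\<close>

definition char_vec :: "('a, 'm) ring_scheme list \<Rightarrow> nat set \<Rightarrow> 'a list" where
  "char_vec Fs A =
     map (\<lambda>k. if Suc k \<in> A then \<one>\<^bsub>Fs ! k\<^esub> else \<zero>\<^bsub>Fs ! k\<^esub>) [0..<length Fs]"

lemma char_vec_closed:
  assumes "\<And>i. i < length Fs \<Longrightarrow> ring (Fs ! i)"
  shows "char_vec Fs A \<in> carrier (RDirProd_list Fs)"
  by (auto simp: RDirProd_list_carrier_iff char_vec_def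
      intro: ring.ring_simprules(2,6) assms)

lemma supp_char_vec:
  assumes "\<And>i. i < length Fs \<Longrightarrow> domain (Fs ! i)"
  shows "supp Fs (char_vec Fs A) = A \<inter> {1..length Fs}"
proof -
  have "char_vec Fs A ! (i - 1) \<noteq> \<zero>\<^bsub>Fs ! (i - 1)\<^esub> \<longleftrightarrow> i \<in> A" if "i \<in> {1..length Fs}" for i
  proof -
    have k: "i - 1 < length Fs" using that by auto
    have "\<one>\<^bsub>Fs ! (i - 1)\<^esub> \<noteq> \<zero>\<^bsub>Fs ! (i - 1)\<^esub>"
      using assms[OF k] by (rule domain.one_not_zero)
    with that k show ?thesis by (simp add: char_vec_def)
  qed
  thus ?thesis unfolding supp_def by blast
qed

text \<open>Both complements are nonempty. A choice with \<open>i = j\<close> is forced only if they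
  are the same singleton, and then \<open>A = B\<close>.\<close>

lemma obtain_distinct_missing:
  assumes "A \<subset> S" "B \<subset> S" "A \<noteq> B"
  obtains i j where "i \<in> S - A" "j \<in> S - B" "i \<noteq> j"
  using assms by blast

context
  fixes Fs :: "('a, 'm) ring_scheme list"
  assumes domains: "\<And>i. i < length Fs \<Longrightarrow> domain (Fs ! i)"
begin

lemma rings: "i < length Fs \<Longrightarrow> ring (Fs ! i)"
  using domains by (intro cring.axioms(1) domain.axioms(1))

interpretation P: ring "RDirProd_list Fs"
  by (rule RDirProd_list_is_ring) (rule rings)

lemma char_vec_in_carrier: "char_vec Fs A \<in> carrier (RDirProd_list Fs)"
  by (rule char_vec_closed) (rule rings)

lemma mult_eq_zero_iff_supp_disjoint:
  assumes "x \<in> carrier (RDirProd_list Fs)" "y \<in> carrier (RDirProd_list Fs)"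
  shows "x \<otimes>\<^bsub>RDirProd_list Fs\<^esub> y = \<zero>\<^bsub>RDirProd_list Fs\<^esub> \<longleftrightarrow>
           supp Fs x \<inter> supp Fs y = {}"
  using supp_eq_empty_iff[OF P.ring_axioms, of "x \<otimes>\<^bsub>RDirProd_list Fs\<^esub> y"]
    supp_mult[OF domains assms] assms
  by auto

lemma char_vec_eq_zero_iff:
  "char_vec Fs A = \<zero>\<^bsub>RDirProd_list Fs\<^esub> \<longleftrightarrow> A \<inter> {1..length Fs} = {}"
  using supp_eq_empty_iff[OF P.ring_axioms char_vec_in_carrier] supp_char_vec[OF domains]
  by auto

text \<open>Being a nonzero zero-divisor is automatic here: \<open>x\<close> is nonzero because
  \<open>A\<close> is nonempty, and the idempotent at a coordinate outside \<open>A\<close>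
  annihilates it.\<close>

lemma supp_class_eq:
  assumes "A \<noteq> {}" "A \<subset> {1..length Fs}"
  shows "supp_class Fs A = {x \<in> carrier (RDirProd_list Fs). supp Fs x = A}"
proof -
  obtain i where i: "i \<in> {1..length Fs}" "i \<notin> A" using assms by blast
  have "x \<in> nonzero_zero_divisors (RDirProd_list Fs)"
    if x: "x \<in> carrier (RDirProd_list Fs)" "supp Fs x = A" for x
  proof -
    have "x \<noteq> \<zero>\<^bsub>RDirProd_list Fs\<^esub>"
      using supp_eq_empty_iff[OF P.ring_axioms x(1)] x(2) assms(1) by simp
    moreover have "x \<otimes>\<^bsub>RDirProd_list Fs\<^esub> char_vec Fs {i} = \<zero>\<^bsub>RDirProd_list Fs\<^esub>"
      using i x
      by (simp add: mult_eq_zero_iff_supp_disjoint char_vec_in_carrier supp_char_vec[OF domains])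
    moreover have "char_vec Fs {i} \<noteq> \<zero>\<^bsub>RDirProd_list Fs\<^esub>"
      using i by (simp add: char_vec_eq_zero_iff)
    ultimately show ?thesis
      using x(1) char_vec_in_carrier by (auto simp: nonzero_zero_divisors_def zero_divisors_def)
  qed
  thus ?thesis
    by (auto simp: supp_class_def nonzero_zero_divisors_def zero_divisors_def)
qed

lemma supp_classes_weakly_adjacent:
  assumes A: "A \<noteq> {}" "A \<subset> {1..length Fs}" and B: "B \<noteq> {}" "B \<subset> {1..length Fs}"
    and "A \<noteq> B" and xy: "x \<in> supp_class Fs A" "y \<in> supp_class Fs B"
  shows "(x, y) \<in> parcs (weak_zero_divisor_graph (RDirProd_list Fs))"
proof -
  obtain i j where ij: "i \<in> {1..length Fs} - A" "j \<in> {1..length Fs} - B" "i \<noteq> j"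
    using A(2) B(2) \<open>A \<noteq> B\<close> by (rule obtain_distinct_missing)
  have "char_vec Fs {i} \<in> Ann (RDirProd_list Fs) x" "char_vec Fs {j} \<in> Ann (RDirProd_list Fs) y"
    using xy ij
    by (simp_all add: supp_class_eq[OF A] supp_class_eq[OF B] Ann_def char_vec_in_carrier
        mult_eq_zero_iff_supp_disjoint supp_char_vec[OF domains])
  moreover have "char_vec Fs {i} \<otimes>\<^bsub>RDirProd_list Fs\<^esub> char_vec Fs {j} = \<zero>\<^bsub>RDirProd_list Fs\<^esub>"
    using ij by (simp add: char_vec_in_carrier mult_eq_zero_iff_supp_disjoint
        supp_char_vec[OF domains])
  moreover have "char_vec Fs {i} \<noteq> \<zero>\<^bsub>RDirProd_list Fs\<^esub>"
    "char_vec Fs {j} \<noteq> \<zero>\<^bsub>RDirProd_list Fs\<^esub>"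
    using ij by (simp_all add: char_vec_eq_zero_iff)
  moreover have "x \<in> nonzero_zero_divisors (RDirProd_list Fs)"
    "y \<in> nonzero_zero_divisors (RDirProd_list Fs)" "x \<noteq> y"
    using xy \<open>A \<noteq> B\<close> by (auto simp: supp_class_def)
  ultimately show ?thesis
    unfolding weak_zero_divisor_graph_def by auto
qed

lemma supp_classes_adjacent_in_difference_iff:
  assumes A: "A \<noteq> {}" "A \<subset> {1..length Fs}" and B: "B \<noteq> {}" "B \<subset> {1..length Fs}"
    and "A \<noteq> B" and xy: "x \<in> supp_class Fs A" "y \<in> supp_class Fs B"
  shows "(x, y) \<in> parcs (weak_difference_graph (RDirProd_list Fs)) \<longleftrightarrow> A \<inter> B \<noteq> {}"
proof -
  \<comment> \<open>Different supports force \<open>x \<noteq> y\<close>, so of the adjacency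
    condition only the vanishing product remains.\<close>
  have "(x, y) \<in> parcs (zero_divisor_graph (RDirProd_list Fs)) \<longleftrightarrow> 
          x \<otimes>\<^bsub>RDirProd_list Fs\<^esub> y = \<zero>\<^bsub>RDirProd_list Fs\<^esub>"
    using xy \<open>A \<noteq> B\<close> by (auto simp: zero_divisor_graph_def supp_class_def)
  also have "\<dots> \<longleftrightarrow> A \<inter> B = {}"
    using xy by (simp add: supp_class_eq[OF A] supp_class_eq[OF B] mult_eq_zero_iff_supp_disjoint)
  \<comment> \<open>Deleting isolated vertices leaves \<open>parcs\<close> unchanged, so the arcs
    are the plain set difference.\<close>
  finally show ?thesis
    using supp_classes_weakly_adjacent[OF assms]
    by (simp add: weak_difference_graph_def delete_isolated_def)
qed

text \<open>Support classes are nonempty, so complete joining is never vacuous.\<close>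

lemma char_vec_in_supp_class:
  assumes "A \<noteq> {}" "A \<subset> {1..length Fs}"
  shows "char_vec Fs A \<in> supp_class Fs A"
  using assms by (auto simp: supp_class_eq[OF assms] char_vec_in_carrier supp_char_vec[OF domains])

text \<open>Adjacency depends on \<open>A\<close> and \<open>B\<close> alone, so one pair of
  representatives decides it for all pairs.\<close>

lemma supp_classes_completely_joined_iff:
  assumes "A \<noteq> {}" "A \<subset> {1..length Fs}" "B \<noteq> {}" "B \<subset> {1..length Fs}" "A \<noteq> B"
  shows "completely_joined (weak_difference_graph (RDirProd_list Fs))
           (supp_class Fs A) (supp_class Fs B) \<longleftrightarrow> A \<inter> B \<noteq> {}"
  using supp_classes_adjacent_in_difference_iff[OF assms]
    char_vec_in_supp_class[OF assms(1,2)] char_vec_in_supp_class[OF assms(3,4)]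
  by (auto simp: completely_joined_def)

end

theorem corollary3p2:
  fixes Fs :: "('a, 'm) ring_scheme list" and t :: nat and A B :: "nat set"
  assumes "length Fs = t"
    and "\<And>i. i < t \<Longrightarrow> field (Fs ! i)"
    and "\<And>i. i < t \<Longrightarrow> finite (carrier (Fs ! i))"
    and "A \<noteq> {}" and "A \<subset> {1..t}"
    and "B \<noteq> {}" and "B \<subset> {1..t}"
    and "A \<noteq> B"
  shows "card (({1..t} - A) \<union> ({1..t} - B)) \<ge> 2 \<and>
         (completely_joined (weak_difference_graph (RDirProd_list Fs))
            (supp_class Fs A) (supp_class Fs B) \<longleftrightarrow> A \<inter> B \<noteq> {})"
proof
  \<comment> \<open>The kind of pair that yields the annihilators also gives two elements of the
    union of the complements.\<close>
  obtain i j where "i \<in> {1..t} - A" "j \<in> {1..t} - B" "i \<noteq> j"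
    using assms(5,7,8) by (rule obtain_distinct_missing)
  then have "card {i, j} \<le> card (({1..t} - A) \<union> ({1..t} - B))"
    by (intro card_mono) auto
  with \<open>i \<noteq> j\<close> show "card (({1..t} - A) \<union> ({1..t} - B)) \<ge> 2" by simp
  have "domain (Fs ! i)" if "i < length Fs" for i
    using assms(1,2) that by (auto intro: field.axioms(1))
  with assms show "completely_joined (weak_difference_graph (RDirProd_list Fs))
      (supp_class Fs A) (supp_class Fs B) \<longleftrightarrow> A \<inter> B \<noteq> {}"
    by (intro supp_classes_completely_joined_iff) auto
qed

end
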